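(* Let $n\ge 1$, $N\ge 2$, $K\ge 2$ be integers and let $c,d\ge 0$. Let $f:\mathbb{R}^n\to\mathbb{R}^n$ be continuous and suppose there is a constant $\alpha\in\mathbb{R}$ such that $(x-y)^{\top}[f(x)-f(y)]\le \alpha (x-y)^{\top}(x-y)$ for all $x,y\in\mathbb{R}^n$. Let $A=(a_{ij})\in\mathbb{R}^{N\times N}$ and $B=(b_{kl})\in\mathbb{R}^{K\times K}$ be symmetric matrices with nonnegative off-diagonal entries and all row sums equal to zero. Let the eigenvalues (counted with multiplicity) of $A$ be $0=\mu_1\ge\mu_2\ge\cdots\ge\mu_N$ and those of $B$ be $0=\nu_1\ge\nu_2\ge\cdots\ge\nu_K$. Consider the multiplex network $$\frac{d x_i^k(t)}{dt}=f(x_i^k(t))+c\sum_{j=1}^{N}a_{ij}x_j^k(t)+d\sum_{l=1}^{K}b_{kl}x_i^l(t),\qquad i=1,\dots,N,\ k=1,\dots,K,$$ where $x_i^k(t)\in\mathbb{R}^n$ is the state of the $i$th node in the $k$th layer. Then the network realizes (i) intra-layer synchronization if $c\mu_2+\alpha<0$; (ii) inter-layer synchronization if $d\nu_2+\alpha<0$; (iii) complete synchronization if $\max\{c\mu_2,d\nu_2\}+\alpha<0$.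
   Context: Definitions (each required for every solution on $[0,\infty)$). Intra-layer synchronization: all nodes within the same layer evolve synchronously, i.e. $\lim_{t\to\infty}\|x_i^k(t)-x_j^k(t)\|=0$ for all $1\le i,j\le N$ and all $1\le k\le K$. Inter-layer synchronization: each node evolves synchronously with all its counterparts in other layers, i.e. $\lim_{t\to\infty}\|x_i^k(t)-x_i^l(t)\|=0$ for all $1\le i\le N$ and all $1\le k,l\le K$. Complete synchronization: $\lim_{t\to\infty}\|x_i^k(t)-x_j^l(t)\|=0$ for all $1\le i,j\le N$ and all $1\le k,l\le K$. *)

theory Defs
  imports "HOL-Analysis.Analysis" "HOL-Computational_Algebra.Computational_Algebra"
begin

definition coupling_matrix :: "real ^ 'm ^ 'm \<Rightarrow> bool" where
  "coupling_matrix A \<longleftrightarrow>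
     transpose A = A \<and>
     (\<forall>i j. i \<noteq> j \<longrightarrow> A $ i $ j \<ge> 0) \<and>
     (\<forall>i. (\<Sum>j\<in>UNIV. A $ i $ j) = 0)"

definition charpoly :: "real ^ 'm ^ 'm \<Rightarrow> real poly" where
  "charpoly A = det (mat [:0, 1:] - map_matrix (\<lambda>a. [:a:]) A)"

text \<open>
  \<open>\<mu> 1, \<dots>, \<mu> m\<close> (with \<open>m\<close> the size of \<open>A\<close>) list all eigenvalues of \<open>A\<close> in nonincreasing order,
  repeated according to multiplicity as roots of the characteristic polynomial. Values of \<open>\<mu>\<close>
  outside \<open>{1..m}\<close> are irrelevant. Since \<open>\<mu>\<close> has \<open>m\<close> entries, all eigenvalues are required to be
  real, which is automatic for symmetric \<open>A\<close>.
\<close>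
definition ordered_eigenvalues :: "real ^ 'm ^ 'm \<Rightarrow> (nat \<Rightarrow> real) \<Rightarrow> bool" where
  "ordered_eigenvalues A \<mu> \<longleftrightarrow>
     image_mset \<mu> (mset_set {1..CARD('m)}) = proots (charpoly A) \<and>
     antimono_on {1..CARD('m)} \<mu>"

text \<open>
  The state \<open>x\<^sub>i\<^sup>k(t)\<close> of node \<open>i\<close> in layer \<open>k\<close> at time \<open>t\<close> is \<open>x i k t\<close>. A solution is one on
  \<open>[0, \<infinity>)\<close>, with the one-sided derivative at \<open>0\<close>.
\<close>
definition network_solution ::
  "(real ^ 'n \<Rightarrow> real ^ 'n) \<Rightarrow> real \<Rightarrow> real ^ 'N ^ 'N \<Rightarrow> real \<Rightarrow> real ^ 'K ^ 'K
    \<Rightarrow> ('N \<Rightarrow> 'K \<Rightarrow> real \<Rightarrow> real ^ 'n) \<Rightarrow> bool" where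
  "network_solution f c A d B x \<longleftrightarrow>
     (\<forall>i k. \<forall>t\<ge>0.
        (x i k has_vector_derivative
           f (x i k t) + c *\<^sub>R (\<Sum>j\<in>UNIV. A $ i $ j *\<^sub>R x j k t)
                       + d *\<^sub>R (\<Sum>l\<in>UNIV. B $ k $ l *\<^sub>R x i l t))
        (at t within {0..}))"

definition intra_layer_synchronization ::
  "(real ^ 'n \<Rightarrow> real ^ 'n) \<Rightarrow> real \<Rightarrow> real ^ 'N ^ 'N \<Rightarrow> real \<Rightarrow> real ^ 'K ^ 'K \<Rightarrow> bool" where
  "intra_layer_synchronization f c A d B \<longleftrightarrow>
     (\<forall>x. network_solution f c A d B x \<longrightarrow>
        (\<forall>i j k. ((\<lambda>t. norm (x i k t - x j k t)) \<longlongrightarrow> 0) at_top))"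

definition inter_layer_synchronization ::
  "(real ^ 'n \<Rightarrow> real ^ 'n) \<Rightarrow> real \<Rightarrow> real ^ 'N ^ 'N \<Rightarrow> real \<Rightarrow> real ^ 'K ^ 'K \<Rightarrow> bool" where
  "inter_layer_synchronization f c A d B \<longleftrightarrow>
     (\<forall>x. network_solution f c A d B x \<longrightarrow>
        (\<forall>i k l. ((\<lambda>t. norm (x i k t - x i l t)) \<longlongrightarrow> 0) at_top))"

definition complete_synchronization ::
  "(real ^ 'n \<Rightarrow> real ^ 'n) \<Rightarrow> real \<Rightarrow> real ^ 'N ^ 'N \<Rightarrow> real \<Rightarrow> real ^ 'K ^ 'K \<Rightarrow> bool" where
  "complete_synchronization f c A d B \<longleftrightarrow>
     (\<forall>x. network_solution f c A d B x \<longrightarrow>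
        (\<forall>i j k l. ((\<lambda>t. norm (x i k t - x j l t)) \<longlongrightarrow> 0) at_top))"

end

theory Submission
  imports Defs
begin

text \<open>
  For each layer \<open>k\<close> let \<open>e\<^sub>i\<^sup>k\<close> be the deviation of \<open>x\<^sub>i\<^sup>k\<close> from the mean of layer \<open>k\<close>, and
  let \<open>V = \<Sum>\<^sub>i\<^sub>k |e\<^sub>i\<^sup>k|\<^sup>2\<close>. Since \<open>\<Sum>\<^sub>i e\<^sub>i\<^sup>k = 0\<close>, the layer means drop out of \<open>V'\<close>: the nonlinearity
  contributes at most \<open>2\<alpha>V\<close>, the intra-layer coupling at most \<open>2c\<mu>\<^sub>2V\<close> (Rayleigh quotient on the
  complement of the constant vectors), and the inter-layer coupling is nonpositive because \<open>B\<close> is negative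
  semidefinite. So \<open>V' \<le> 2(c\<mu>\<^sub>2 + \<alpha>)V\<close> and \<open>V\<close> decays exponentially. The inter-layer case is the same
  statement with the roles of nodes and layers exchanged, and complete synchronization follows by
  the triangle inequality.

  The bound by \<open>\<mu>\<^sub>2\<close> needs no spectral theorem: a maximizer \<open>v\<close> of the Rayleigh quotient on the
  complement of the constants is an eigenvector, and the eigenvectors \<open>1\<close> and \<open>v\<close> together
  split off two linear factors of the characteristic polynomial, so that the maximum is one of
  \<open>\<mu>\<^sub>2, \<mu>\<^sub>3, \<dots>\<close> even when it is \<open>0\<close>.
\<close>

no_notation fps_nth (infixl "$" 75)

section \<open>Eigenvectors, roots of the characteristic polynomial and the Rayleigh
  quotient\<close>

lemma det_map_matrix_const_poly:
  fixes P :: "'a::{idom,ring_char_0} ^ 'm ^ 'm"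
  shows "det (map_matrix (\<lambda>a. [:a:]) P) = [:det P:]"
proof -
  have "poly (det (map_matrix (\<lambda>a. [:a:]) P)) t = poly [:det P:] t" for t
    by (simp add: det_def poly_sum poly_prod)
  then show ?thesis
    by (rule poly_eq_poly_eq_iff[THEN iffD1, OF ext])
qed

text \<open>Putting the left eigenvectors 1 and \<open>v\<close> in place of two rows of the
  identity gives an invertible \<open>P\<close>. Multiplying \<open>X I - A\<close> by
  \<open>P\<close> from the left makes these two rows divisible by \<open>X - \<kappa>\<close> and
  \<open>X - \<rho>\<close>, and both factors come out of the determinant. Thus the roots are
  counted with multiplicity even if \<open>\<kappa> = \<rho>\<close>.\<close>

lemma charpoly_roots_of_left_eigenvectors:
  fixes A :: "real ^ 'm ^ 'm" and v :: "real ^ 'm"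
  assumes one: "1 v* A = \<kappa> *\<^sub>R 1" and eig: "v v* A = \<rho> *\<^sub>R v"
    and nonconst: "v $ a \<noteq> v $ b" and nz: "charpoly A \<noteq> 0"
  shows "{#\<kappa>, \<rho>#} \<subseteq># proots (charpoly A)"
proof -
  \<comment> \<open>Rows \<open>a\<close> and \<open>b\<close> of \<open>P (X I - A)\<close> are \<open>(X - \<kappa>) 1\<close> and \<open>(X - \<rho>) v\<close>.\<close>
  define P :: "real ^ 'm ^ 'm" where
    "P = (\<chi> i. if i = a then 1 else if i = b then v else axis i 1)"
  define L where "L = map_matrix (\<lambda>a. [:a:]) P"
  define M where "M = mat [:0, 1:] - map_matrix (\<lambda>a. [:a:]) A"
  define r where "r = (\<lambda>i. if i = a then [:-\<kappa>, 1:] else if i = b then [:-\<rho>, 1:] else 1)"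
  define Q where "Q = (\<lambda>i. if i = a \<or> i = b then L $ i else M $ i)"
  have ab: "a \<noteq> b"
    using nonconst by auto
  \<comment> \<open>The identity rows kill all coordinates of \<open>z\<close> except
    \<open>a\<close> and \<open>b\<close>; what remains is a 2 by 2 system with determinant
    \<open>v $ b - v $ a\<close>, which is nonzero.\<close>
  have "z = 0" if "P *v z = 0" for z
  proof -
    have Pz: "P $ i \<bullet> z = 0" for i
      using that by (metis matrix_vector_mul_component zero_index)
    have rest: "z $ i = 0" if "i \<noteq> a" "i \<noteq> b" for i
      using Pz[of i] that by (simp add: P_def inner_axis')
    have split: "(\<Sum>i\<in>UNIV. w $ i * z $ i) = w $ a * z $ a + w $ b * z $ b" for w :: "real ^ 'm"
    proof -
      have "(\<Sum>i\<in>UNIV. w $ i * z $ i) = (\<Sum>i\<in>{a, b}. w $ i * z $ i)"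
        by (rule sum.mono_neutral_right) (auto simp: rest)
      then show ?thesis
        using ab by simp
    qed
    have 1: "z $ a + z $ b = 0" and 2: "v $ a * z $ a + v $ b * z $ b = 0"
      using Pz[of a] Pz[of b] ab split[of 1] split[of v] by (simp_all add: P_def inner_vec_def)
    have "(v $ a - v $ b) * z $ a = 0"
      using 1 2 by (simp add: algebra_simps eq_neg_iff_add_eq_0[symmetric])
    then have "z $ a = 0" "z $ b = 0"
      using 1 nonconst by auto
    then show "z = 0"
      using rest by (metis vec_eq_iff zero_index)
  qed
  then have "det P \<noteq> 0"
    by (metis invertible_det_nz invertible_left_inverse matrix_left_invertible_ker)
  have left: "(\<Sum>k\<in>UNIV. L $ i $ k * M $ k $ j) = [:-\<tau>, 1:] * L $ i $ j"
    if "P $ i v* A = \<tau> *\<^sub>R P $ i" for i j \<tau>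
  proof -
    have *: "(\<Sum>k\<in>UNIV. A $ k $ j * P $ i $ k) = \<tau> * P $ i $ j"
      using arg_cong[OF that, of "\<lambda>u. u $ j"]
      by (simp add: vector_matrix_mult_def mult.commute)
    have "poly (\<Sum>k\<in>UNIV. L $ i $ k * M $ k $ j) t = poly ([:-\<tau>, 1:] * L $ i $ j) t" for t
    proof -
      have "poly (\<Sum>k\<in>UNIV. L $ i $ k * M $ k $ j) t
          = (\<Sum>k\<in>UNIV. P $ i $ k * ((if k = j then t else 0) - A $ k $ j))"
        unfolding poly_sum by (rule sum.cong) (auto simp: L_def M_def mat_def)
      also have "\<dots> = (\<Sum>k\<in>UNIV. (if k = j then t * P $ i $ k else 0))
          - (\<Sum>k\<in>UNIV. A $ k $ j * P $ i $ k)"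
        unfolding sum_subtractf[symmetric] by (rule sum.cong) (auto simp: algebra_simps)
      also have "\<dots> = poly ([:-\<tau>, 1:] * L $ i $ j) t"
        by (simp add: * L_def algebra_simps)
      finally show ?thesis .
    qed
    then show ?thesis
      by (rule poly_eq_poly_eq_iff[THEN iffD1, OF ext])
  qed
  have "L ** M = (\<chi> i. r i *s Q i)"
  proof -
    have "(\<Sum>k\<in>UNIV. L $ i $ k * M $ k $ j) = r i * Q i $ j" for i j
    proof (cases "i = a \<or> i = b")
      case True
      then show ?thesis
        using left[of a \<kappa> j] left[of b \<rho> j] one eig ab by (auto simp: P_def r_def Q_def)
    next
      case False
      have "(\<Sum>k\<in>UNIV. L $ i $ k * M $ k $ j) = (\<Sum>k\<in>UNIV. if k = i then M $ k $ j else 0)"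
        by (rule sum.cong) (use False in \<open>auto simp: L_def P_def axis_def\<close>)
      then show ?thesis
        using False by (simp add: r_def Q_def)
    qed
    then show ?thesis
      by (simp add: matrix_matrix_mult_def vec_eq_iff)
  qed
  then have "det L * det M = prod r UNIV * det (\<chi> i. Q i)"
    by (metis det_mul det_rows_mul)
  moreover have "det L = [:det P:]"
    unfolding L_def by (rule det_map_matrix_const_poly)
  moreover have "prod r UNIV = [:-\<kappa>, 1:] * [:-\<rho>, 1:]"
  proof -
    have "prod r UNIV = prod r {a, b}"
      by (rule prod.mono_neutral_right) (auto simp: r_def)
    then show ?thesis
      using ab by (simp add: r_def)
  qed
  moreover have "det M = charpoly A"
    by (simp add: M_def charpoly_def)
  ultimately have "[:det P:] * charpoly A = [:-\<kappa>, 1:] * [:-\<rho>, 1:] * det (\<chi> i. Q i)"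
    by (simp only:)
  then have eq: "smult (det P) (charpoly A) = [:-\<kappa>, 1:] * ([:-\<rho>, 1:] * det (\<chi> i. Q i))"
    by (simp only: mult.assoc) simp
  have linear: "[:-\<tau>, 1:] \<noteq> (0 :: real poly)" for \<tau>
    by simp
  have root: "proots ([:-\<tau>, 1:] * p) = {#\<tau>#} + proots p" if "p \<noteq> 0" for \<tau> :: real and p
    using proots_mult[OF linear that, of \<tau>] by (simp only: proots_linear_factor minus_minus)
  have Qnz: "det (\<chi> i. Q i) \<noteq> 0"
    using eq nz \<open>det P \<noteq> 0\<close> by auto
  have "proots (charpoly A) = proots (smult (det P) (charpoly A))"
    using \<open>det P \<noteq> 0\<close> by simp
  also have "\<dots> = {#\<kappa>#} + ({#\<rho>#} + proots (det (\<chi> i. Q i)))"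
    unfolding eq using Qnz linear by (metis root mult_eq_0_iff)
  finally show ?thesis
    by simp
qed

text \<open>The quadratic form attains its maximum on the compact unit sphere of \<open>S\<close>.
  By invariance the residual \<open>g v - \<rho> *\<^sub>R v\<close> lies in \<open>S\<close>, so it
  is an admissible direction of variation; maximality forces it to vanish.\<close>

lemma selfadjoint_max_eigenvector:
  fixes g :: "'a::euclidean_space \<Rightarrow> 'a"
  assumes lin: "linear g" and sym: "\<And>x y. g x \<bullet> y = x \<bullet> g y"
    and S: "subspace S" "S \<noteq> {0}" and inv: "\<And>x. x \<in> S \<Longrightarrow> g x \<in> S"
  obtains v \<rho> where "v \<in> S" "v \<noteq> 0" "g v = \<rho> *\<^sub>R v"
    "\<And>u. u \<in> S \<Longrightarrow> u \<bullet> g u \<le> \<rho> * (u \<bullet> u)"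
proof -
  interpret linear g by (rule lin)
  let ?K = "sphere 0 1 \<inter> S"
  obtain w where w: "w \<in> S" "w \<noteq> 0"
    using S subspace_0 by blast
  then have "(1 / norm w) *\<^sub>R w \<in> ?K"
    using S by (simp add: subspace_scale)
  moreover have "compact ?K"
    by (intro compact_Int_closed compact_sphere closed_subspace S)
  moreover have "continuous_on ?K (\<lambda>u. u \<bullet> g u)"
    by (intro continuous_intros linear_continuous_on linear_conv_bounded_linear[THEN iffD1] lin)
  ultimately obtain v where v: "v \<in> ?K" and vmax: "\<And>u. u \<in> ?K \<Longrightarrow> u \<bullet> g u \<le> v \<bullet> g v"
    using continuous_attains_sup[of ?K "\<lambda>u. u \<bullet> g u"] by blast
  define \<rho> where "\<rho> = v \<bullet> g v"
  have bound: "u \<bullet> g u \<le> \<rho> * (u \<bullet> u)" if "u \<in> S" for u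
  proof (cases "u = 0")
    case False
    have "(1 / norm u) *\<^sub>R u \<in> ?K"
      using False that S by (simp add: subspace_scale)
    from vmax[OF this] have "(u \<bullet> g u) / (norm u)\<^sup>2 \<le> \<rho>"
      by (simp add: \<rho>_def scale power2_eq_square)
    then show ?thesis
      using False by (simp add: divide_le_eq power2_norm_eq_inner)
  qed (simp add: zero)
  have vv: "v \<bullet> v = 1"
    using v by (simp add: norm_eq_1)
  \<comment> \<open>First-order optimality of \<open>v\<close>, tested in the direction of the residual itself.\<close>
  define r where "r = g v - \<rho> *\<^sub>R v"
  define q where "q = r \<bullet> r"
  define h where "h = r \<bullet> g r - \<rho> * q"
  have rS: "r \<in> S"
    using v S inv by (auto simp: r_def intro!: subspace_diff subspace_scale)
  have quad: "s * (2 * q + s * h) \<le> 0" for s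
  proof -
    have "v + s *\<^sub>R r \<in> S"
      using v rS S by (auto intro!: subspace_add subspace_scale)
    note le = bound[OF this]
    have lhs: "(v + s *\<^sub>R r) \<bullet> g (v + s *\<^sub>R r) = \<rho> + 2 * s * (r \<bullet> g v) + s * s * (r \<bullet> g r)"
      using sym[of v r] by (simp add: add scale algebra_simps \<rho>_def inner_commute)
    have rhs: "(v + s *\<^sub>R r) \<bullet> (v + s *\<^sub>R r) = 1 + 2 * s * (r \<bullet> v) + s * s * q"
      using vv by (simp add: q_def algebra_simps inner_commute)
    have "r \<bullet> g v = q + \<rho> * (r \<bullet> v)"
      by (simp add: q_def r_def algebra_simps)
    then show ?thesis
      using le unfolding lhs rhs by (simp add: h_def algebra_simps)
  qed
  have "q = 0"
  proof (rule ccontr)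
    assume "q \<noteq> 0"
    then have q: "q > 0"
      by (simp add: q_def)
    \<comment> \<open>Small enough for the linear term to dominate:
      \<open>s * \<bar>h\<bar> = q - s\<close>, hence \<open>2 * q + s * h \<ge> q + s > 0\<close>,
      against \<open>quad\<close>.\<close>
    define s where "s = q / (\<bar>h\<bar> + 1)"
    have s: "s > 0" "s * (\<bar>h\<bar> + 1) = q"
      using q by (simp_all add: s_def add_nonneg_pos)
    have "s * h \<ge> - (s * \<bar>h\<bar>)"
      using s(1) mult_left_mono[of "-\<bar>h\<bar>" h s] by simp
    then have "2 * q + s * h > 0"
      using s q by (simp add: algebra_simps)
    then show False
      using quad[of s] s(1) by (simp add: mult_le_0_iff)
  qed
  then have "g v = \<rho> *\<^sub>R v"
    by (simp add: q_def r_def)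
  moreover have "v \<noteq> 0"
    using vv by auto
  ultimately show thesis
    using that v bound by blast
qed

section \<open>Quadratic forms of coupling matrices\<close>

lemma coupling_matrix_sym:
  assumes "coupling_matrix A"
  shows "A $ i $ j = A $ j $ i"
proof -
  have "transpose A $ i $ j = A $ i $ j"
    using assms by (simp add: coupling_matrix_def)
  then show ?thesis
    by (simp add: transpose_def)
qed

lemma coupling_matrix_row_sum: "coupling_matrix A \<Longrightarrow> (\<Sum>j\<in>UNIV. A $ i $ j) = 0"
  by (simp add: coupling_matrix_def)

lemma coupling_matrix_col_sum:
  assumes "coupling_matrix A"
  shows "(\<Sum>i\<in>UNIV. A $ i $ j) = 0"
proof -
  have "(\<Sum>i\<in>UNIV. A $ i $ j) = (\<Sum>i\<in>UNIV. A $ j $ i)"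
    by (intro sum.cong refl coupling_matrix_sym assms)
  then show ?thesis
    using coupling_matrix_row_sum[OF assms] by simp
qed

text \<open>Since \<open>A\<close> is symmetric and annihilates 1, the orthogonal complement of 1 is
  invariant and carries a maximizing eigenvector \<open>v\<close>. The pair 1, \<open>v\<close>
  yields the roots 0 and \<open>\<rho>\<close>; cancelling 0 against \<open>\<mu> 1\<close> leaves
  \<open>\<rho>\<close> among the later eigenvalues.\<close>

lemma coupling_matrix_Rayleigh:
  fixes A :: "real ^ 'm ^ 'm" and u :: "real ^ 'm"
  assumes A: "coupling_matrix A" and card: "CARD('m) \<ge> 2"
    and ev: "ordered_eigenvalues A \<mu>" "\<mu> 1 = 0" and u: "(\<Sum>i\<in>UNIV. u $ i) = 0"
  shows "u \<bullet> (A *v u) \<le> \<mu> 2 * (u \<bullet> u)"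
proof (cases "u = 0")
  case False
  let ?S = "{u. 1 \<bullet> u = (0::real)} :: (real ^ 'm) set"
  have trA: "x v* A = A *v x" for x
    by (metis A coupling_matrix_def transpose_matrix_vector)
  have A1: "A *v 1 = 0"
    using A by (simp add: vec_eq_iff matrix_vector_mult_def coupling_matrix_row_sum)
  have sym: "(A *v x) \<bullet> y = x \<bullet> (A *v y)" for x y
    by (metis trA dot_lmul_matrix)
  have inS: "u \<in> ?S"
    using u by (simp add: inner_vec_def)
  have "subspace ?S"
    by (rule subspace_hyperplane)
  moreover have "?S \<noteq> {0}"
    using inS False by blast
  moreover have "A *v x \<in> ?S" if "x \<in> ?S" for x
    using sym[of 1 x] A1 by simp
  ultimately obtain v \<rho> where v: "v \<in> ?S" "v \<noteq> 0" "A *v v = \<rho> *\<^sub>R v"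
    and max: "\<And>u. u \<in> ?S \<Longrightarrow> u \<bullet> (A *v u) \<le> \<rho> * (u \<bullet> u)"
    using selfadjoint_max_eigenvector[of "(*v) A" ?S, OF matrix_vector_mul_linear sym] by blast
  \<comment> \<open>A constant vector orthogonal to 1 would be zero.\<close>
  have "\<exists>a b. v $ a \<noteq> v $ b"
  proof (rule ccontr)
    assume "\<not> ?thesis"
    then have const: "v $ i = v $ j" for i j
      by blast
    have "real CARD('m) * v $ j = 1 \<bullet> v" for j
    proof -
      have "1 \<bullet> v = (\<Sum>i\<in>(UNIV :: 'm set). v $ j)"
        unfolding inner_vec_def by (rule sum.cong, simp, simp, rule const)
      then show ?thesis
        by simp
    qed
    then have "v = 0"
      using v(1) by (simp add: vec_eq_iff)
    then show False
      using v(2) by contradiction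
  qed
  then obtain a b where ab: "v $ a \<noteq> v $ b"
    by blast
  have ms: "image_mset \<mu> (mset_set {1..CARD('m)}) = proots (charpoly A)"
    and anti: "antimono_on {1..CARD('m)} \<mu>"
    using ev by (auto simp: ordered_eigenvalues_def)
  have "{1..CARD('m)} = insert 1 {2..CARD('m)}"
    using card by auto
  then have split: "proots (charpoly A) = add_mset 0 (image_mset \<mu> (mset_set {2..CARD('m)}))"
    using ms ev(2) by simp
  \<comment> \<open>\<open>proots 0\<close> is the empty multiset by convention, whereas this one
    contains 0.\<close>
  then have "charpoly A \<noteq> 0"
    by auto
  then have "{#0, \<rho>#} \<subseteq># proots (charpoly A)"
    by (intro charpoly_roots_of_left_eigenvectors[of _ _ v _ a b]) (simp_all add: trA A1 v ab)
  then have "\<rho> \<in># image_mset \<mu> (mset_set {2..CARD('m)})"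
    unfolding split by simp
  then obtain i where "2 \<le> i" "i \<le> CARD('m)" "\<rho> = \<mu> i"
    by auto
  then have "\<rho> \<le> \<mu> 2"
    using anti card by (auto simp: monotone_on_def)
  then show ?thesis
    using max[OF inS] by (meson inner_ge_zero mult_right_mono order_trans)
qed simp

text \<open>Vanishing row and column sums turn twice the form into minus the sum of
  \<open>B $ k $ l\<close> times the squared distance of \<open>y k\<close> and \<open>y l\<close>.
  Diagonal terms vanish there and off-diagonal weights are nonnegative.\<close>

lemma coupling_matrix_form_nonpos:
  fixes B :: "real ^ 'm ^ 'm" and y :: "'m \<Rightarrow> 'a::real_inner"
  assumes B: "coupling_matrix B"
  shows "(\<Sum>k\<in>UNIV. \<Sum>l\<in>UNIV. B $ k $ l * (y k \<bullet> y l)) \<le> 0"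
proof -
  let ?W = "\<lambda>g. \<Sum>k\<in>UNIV. \<Sum>l\<in>UNIV. B $ k $ l * g k l"
  have "?W (\<lambda>k l. y k \<bullet> y k) = 0"
    by (simp add: sum_distrib_right[symmetric] coupling_matrix_row_sum[OF B])
  moreover have "?W (\<lambda>k l. y l \<bullet> y l) = 0"
    by (subst sum.swap) (simp add: sum_distrib_right[symmetric] coupling_matrix_col_sum[OF B])
  moreover have "?W (\<lambda>k l. (y k - y l) \<bullet> (y k - y l))
      = ?W (\<lambda>k l. y k \<bullet> y k) + ?W (\<lambda>k l. y l \<bullet> y l) - 2 * ?W (\<lambda>k l. y k \<bullet> y l)"
    unfolding sum_distrib_left sum.distrib[symmetric] sum_subtractf[symmetric]
    by (intro sum.cong) (simp_all add: algebra_simps inner_commute)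
  moreover have "?W (\<lambda>k l. (y k - y l) \<bullet> (y k - y l)) \<ge> 0"
  proof (intro sum_nonneg)
    show "0 \<le> B $ k $ l * ((y k - y l) \<bullet> (y k - y l))" for k l
      using B by (cases "k = l") (auto simp: coupling_matrix_def)
  qed
  ultimately show ?thesis
    by simp
qed

text \<open>The scalar bound is applied to each coordinate \<open>p\<close> of the node states
  separately, and the results are summed over \<open>p\<close>.\<close>

lemma coupling_matrix_Rayleigh_vector:
  fixes A :: "real ^ 'm ^ 'm" and e :: "'m \<Rightarrow> real ^ 'n"
  assumes A: "coupling_matrix A" and card: "CARD('m) \<ge> 2"
    and ev: "ordered_eigenvalues A \<mu>" "\<mu> 1 = 0" and e: "(\<Sum>i\<in>UNIV. e i) = 0"
  shows "(\<Sum>i\<in>UNIV. \<Sum>j\<in>UNIV. A $ i $ j * (e i \<bullet> e j)) \<le> \<mu> 2 * (\<Sum>i\<in>UNIV. e i \<bullet> e i)"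
proof -
  define u where "u p = (\<chi> i. e i $ p)" for p
  have "u p \<bullet> (A *v u p) \<le> \<mu> 2 * (u p \<bullet> u p)" for p
    using arg_cong[OF e, of "\<lambda>z. z $ p"]
    by (intro coupling_matrix_Rayleigh A card ev) (simp add: u_def)
  then have "(\<Sum>p\<in>UNIV. u p \<bullet> (A *v u p)) \<le> (\<Sum>p\<in>UNIV. \<mu> 2 * (u p \<bullet> u p))"
    by (rule sum_mono)
  also have "\<dots> = \<mu> 2 * (\<Sum>i\<in>UNIV. e i \<bullet> e i)"
  proof -
    have "(\<Sum>p\<in>UNIV. u p \<bullet> u p) = (\<Sum>p\<in>UNIV. \<Sum>i\<in>UNIV. e i $ p * e i $ p)"
      by (simp add: u_def inner_vec_def)
    also have "\<dots> = (\<Sum>i\<in>UNIV. e i \<bullet> e i)"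
      by (subst sum.swap) (simp add: inner_vec_def)
    finally show ?thesis
      by (simp add: sum_distrib_left[symmetric])
  qed
  also have "(\<Sum>p\<in>UNIV. u p \<bullet> (A *v u p))
      = (\<Sum>p\<in>UNIV. \<Sum>i\<in>UNIV. \<Sum>j\<in>UNIV. A $ i $ j * (e i $ p * e j $ p))"
    by (simp add: u_def inner_vec_def matrix_vector_mult_def sum_distrib_left mult_ac)
  also have "\<dots> = (\<Sum>i\<in>UNIV. \<Sum>j\<in>UNIV. \<Sum>p\<in>UNIV. A $ i $ j * (e i $ p * e j $ p))"
    by (subst sum.swap, rule sum.cong[OF refl], rule sum.swap)
  also have "\<dots> = (\<Sum>i\<in>UNIV. \<Sum>j\<in>UNIV. A $ i $ j * (e i \<bullet> e j))"
    by (simp add: inner_vec_def sum_distrib_left)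
  finally show ?thesis .
qed

section \<open>Exponential decay from a differential inequality\<close>

text \<open>Gronwall argument: the integrating factor \<open>exp (- b * t)\<close> makes
  \<open>G\<close> nonincreasing, so \<open>V\<close> stays below
  \<open>V 0 * exp (b * t)\<close>.\<close>

lemma tendsto_zero_of_derivative_le:
  fixes V V' :: "real \<Rightarrow> real"
  assumes der: "\<And>t. t \<ge> 0 \<Longrightarrow> (V has_real_derivative V' t) (at t within {0..})"
    and le: "\<And>t. t \<ge> 0 \<Longrightarrow> V' t \<le> b * V t" and nonneg: "\<And>t. t \<ge> 0 \<Longrightarrow> V t \<ge> 0" and b: "b < 0"
  shows "(V \<longlongrightarrow> 0) at_top"
proof -
  define G where "G t = V t * exp (- b * t)" for t
  have dG: "(G has_real_derivative (V' t - b * V t) * exp (- b * t)) (at t within {0..})"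
    if "t \<ge> 0" for t
    unfolding G_def using der[OF that] by (auto intro!: derivative_eq_intros simp: algebra_simps)
  have "G t \<le> V 0" if "t \<ge> 0" for t
  proof -
    have "G t \<le> G 0"
    proof (rule DERIV_nonpos_imp_decreasing_open[OF that])
      fix s :: real assume s: "0 < s"
      \<comment> \<open>At interior points the derivative within \<open>{0..}\<close> is the
        two-sided one; the endpoint 0 enters through continuity of \<open>G\<close>.\<close>
      then have "at s within {0..} = at s"
        by (intro at_within_interior) simp
      then show "\<exists>y. DERIV G s :> y \<and> y \<le> 0"
        using dG[of s] le[of s] s by (intro exI[of _ "(V' s - b * V s) * exp (- b * s)"])
          (auto simp: mult_le_0_iff)
    next
      show "continuous_on {0..t} G"
        by (rule continuous_on_subset[of "{0..}"], rule DERIV_continuous_on[OF dG]) auto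
    qed
    then show ?thesis
      by (simp add: G_def)
  qed
  then have upper: "V t \<le> V 0 * exp (b * t)" if "t \<ge> 0" for t
    using that by (fastforce simp: G_def exp_minus field_simps)
  have "((\<lambda>t. V 0 * exp (b * t)) \<longlongrightarrow> V 0 * 0) at_top"
    by (intro tendsto_intros filterlim_compose[OF exp_at_bot]
        filterlim_tendsto_neg_mult_at_bot[OF tendsto_const b] filterlim_ident)
  then have lim: "((\<lambda>t. V 0 * exp (b * t)) \<longlongrightarrow> 0) at_top"
    by simp
  show ?thesis
    by (rule tendsto_sandwich[OF _ _ tendsto_const lim])
      (auto intro!: eventually_at_top_linorderI[of 0] nonneg upper)
qed

section \<open>Lyapunov estimate and the three kinds of synchronization\<close>

lemma intra_layer_synchronizationI:
  fixes f :: "real ^ 'n \<Rightarrow> real ^ 'n" and A :: "real ^ 'N ^ 'N" and B :: "real ^ 'K ^ 'K"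
  assumes card: "CARD('N) \<ge> 2" and c: "c \<ge> 0" and d: "d \<ge> 0"
    and f: "\<And>x y. (x - y) \<bullet> (f x - f y) \<le> \<alpha> * ((x - y) \<bullet> (x - y))"
    and A: "coupling_matrix A" and B: "coupling_matrix B"
    and ev: "ordered_eigenvalues A \<mu>" "\<mu> 1 = 0" and neg: "c * \<mu> 2 + \<alpha> < 0"
  shows "intra_layer_synchronization f c A d B"
  unfolding intra_layer_synchronization_def
proof (intro allI impI)
  fix x :: "'N \<Rightarrow> 'K \<Rightarrow> real \<Rightarrow> real ^ 'n" and i j k
  assume sol: "network_solution f c A d B x"
  define F where "F i k t = f (x i k t) + c *\<^sub>R (\<Sum>j\<in>UNIV. A $ i $ j *\<^sub>R x j k t)
    + d *\<^sub>R (\<Sum>l\<in>UNIV. B $ k $ l *\<^sub>R x i l t)" for i k t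
  have der: "(x i k has_vector_derivative F i k t) (at t within {0..})" if "t \<ge> 0" for i k t
    using sol that unfolding network_solution_def F_def by blast
  define m where "m k t = (1 / real CARD('N)) *\<^sub>R (\<Sum>i\<in>UNIV. x i k t)" for k t
  define m' where "m' k t = (1 / real CARD('N)) *\<^sub>R (\<Sum>i\<in>UNIV. F i k t)" for k t
  define e where "e i k t = x i k t - m k t" for i k t
  have sum_e: "(\<Sum>i\<in>UNIV. e i k t) = 0" for k t
    by (simp add: e_def m_def sum_subtractf sum_constant_scaleR del: sum_constant)
  \<comment> \<open>Any term independent of the node \<open>i\<close> pairs to zero with the
    deviations. This removes \<open>m'\<close>, permits subtracting \<open>f (m k t)\<close>, and
    kills the means in the inter-layer coupling.\<close>
  have e_const: "(\<Sum>i\<in>UNIV. e i k t \<bullet> z) = 0" for k t z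
    by (simp add: inner_sum_left[symmetric] sum_e)
  have e_der: "(e i k has_vector_derivative F i k t - m' k t) (at t within {0..})"
    if "t \<ge> 0" for i k t
    unfolding e_def m_def m'_def using that
    by (intro has_vector_derivative_diff has_vector_derivative_sum der
        bounded_linear.has_vector_derivative[OF bounded_linear_scaleR_right])
  define V where "V t = (\<Sum>k\<in>UNIV. \<Sum>i\<in>UNIV. e i k t \<bullet> e i k t)" for t
  define V' where "V' t = (\<Sum>k\<in>UNIV. \<Sum>i\<in>UNIV. 2 * (e i k t \<bullet> (F i k t - m' k t)))" for t
  have "(V has_real_derivative V' t) (at t within {0..})" if "t \<ge> 0" for t
    unfolding V_def V'_def
  proof (intro DERIV_sum)
    show "((\<lambda>t. e i k t \<bullet> e i k t) has_real_derivative 2 * (e i k t \<bullet> (F i k t - m' k t)))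
        (at t within {0..})" for i k
      using bounded_bilinear.has_vector_derivative
          [OF bounded_bilinear_inner e_der[OF that, of i k] e_der[OF that, of i k]]
      by (simp add: has_real_derivative_iff_has_vector_derivative inner_commute)
  qed
  moreover have "V' t \<le> 2 * (c * \<mu> 2 + \<alpha>) * V t" for t
  proof -
    have "(\<Sum>i\<in>UNIV. e i k t \<bullet> f (x i k t)) \<le> \<alpha> * (\<Sum>i\<in>UNIV. e i k t \<bullet> e i k t)" for k
    proof -
      have "(\<Sum>i\<in>UNIV. e i k t \<bullet> f (x i k t)) = (\<Sum>i\<in>UNIV. e i k t \<bullet> (f (x i k t) - f (m k t)))"
        by (simp add: inner_diff_right sum_subtractf e_const)
      also have "\<dots> \<le> (\<Sum>i\<in>UNIV. \<alpha> * (e i k t \<bullet> e i k t))"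
        unfolding e_def by (intro sum_mono f)
      finally show ?thesis
        by (simp add: sum_distrib_left)
    qed
    then have f_part: "(\<Sum>k\<in>UNIV. \<Sum>i\<in>UNIV. e i k t \<bullet> f (x i k t)) \<le> \<alpha> * V t"
      unfolding V_def by (subst sum_distrib_left) (rule sum_mono)
    have "(\<Sum>i\<in>UNIV. e i k t \<bullet> (\<Sum>j\<in>UNIV. A $ i $ j *\<^sub>R x j k t))
        \<le> \<mu> 2 * (\<Sum>i\<in>UNIV. e i k t \<bullet> e i k t)" for k
    proof -
      \<comment> \<open>Within a layer all nodes share the mean \<open>m k t\<close>, which zero row
        sums of \<open>A\<close> cancel.\<close>
      have "(\<Sum>j\<in>UNIV. A $ i $ j *\<^sub>R x j k t) = (\<Sum>j\<in>UNIV. A $ i $ j *\<^sub>R e j k t)" for i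
        by (simp add: e_def scaleR_diff_right sum_subtractf scaleR_sum_left[symmetric]
            coupling_matrix_row_sum[OF A])
      then show ?thesis
        using coupling_matrix_Rayleigh_vector[OF A card ev sum_e[of k t]]
        by (simp add: inner_sum_right)
    qed
    then have "(\<Sum>k\<in>UNIV. \<Sum>i\<in>UNIV. e i k t \<bullet> (\<Sum>j\<in>UNIV. A $ i $ j *\<^sub>R x j k t)) \<le> \<mu> 2 * V t"
      unfolding V_def by (subst sum_distrib_left) (rule sum_mono)
    then have A_part: "c * (\<Sum>k\<in>UNIV. \<Sum>i\<in>UNIV. e i k t \<bullet> (\<Sum>j\<in>UNIV. A $ i $ j *\<^sub>R x j k t))
        \<le> c * (\<mu> 2 * V t)"
      using c by (rule mult_left_mono)
    \<comment> \<open>The means differ between layers, so row sums of \<open>B\<close> do not cancel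
      them; \<open>e_const\<close> does. Swapping the sums then leaves, for each node, the form of
      \<open>B\<close> across layers.\<close>
    have "(\<Sum>k\<in>UNIV. \<Sum>i\<in>UNIV. e i k t \<bullet> (\<Sum>l\<in>UNIV. B $ k $ l *\<^sub>R x i l t))
        = (\<Sum>k\<in>UNIV. \<Sum>i\<in>UNIV. e i k t \<bullet> (\<Sum>l\<in>UNIV. B $ k $ l *\<^sub>R e i l t))
          + (\<Sum>k\<in>UNIV. \<Sum>i\<in>UNIV. e i k t \<bullet> (\<Sum>l\<in>UNIV. B $ k $ l *\<^sub>R m l t))"
    proof -
      have "x i l t = e i l t + m l t" for i l
        by (simp add: e_def)
      then show ?thesis
        by (simp add: scaleR_add_right sum.distrib inner_add_right)
    qed
    also have "\<dots> = (\<Sum>i\<in>UNIV. \<Sum>k\<in>UNIV. e i k t \<bullet> (\<Sum>l\<in>UNIV. B $ k $ l *\<^sub>R e i l t))"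
      unfolding e_const by simp (rule sum.swap)
    also have "\<dots> \<le> 0"
    proof (rule sum_nonpos)
      show "(\<Sum>k\<in>UNIV. e i k t \<bullet> (\<Sum>l\<in>UNIV. B $ k $ l *\<^sub>R e i l t)) \<le> 0" for i
        using coupling_matrix_form_nonpos[OF B, of "\<lambda>k. e i k t"] by (simp add: inner_sum_right)
    qed
    finally have B_part:
      "d * (\<Sum>k\<in>UNIV. \<Sum>i\<in>UNIV. e i k t \<bullet> (\<Sum>l\<in>UNIV. B $ k $ l *\<^sub>R x i l t)) \<le> 0"
      using d by (simp add: mult_nonneg_nonpos)
    have "V' t = 2 * (\<Sum>k\<in>UNIV. \<Sum>i\<in>UNIV. e i k t \<bullet> F i k t)"
      by (simp add: V'_def inner_diff_right sum_subtractf e_const sum_distrib_left[symmetric])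
    also have "(\<Sum>k\<in>UNIV. \<Sum>i\<in>UNIV. e i k t \<bullet> F i k t)
        = (\<Sum>k\<in>UNIV. \<Sum>i\<in>UNIV. e i k t \<bullet> f (x i k t))
          + c * (\<Sum>k\<in>UNIV. \<Sum>i\<in>UNIV. e i k t \<bullet> (\<Sum>j\<in>UNIV. A $ i $ j *\<^sub>R x j k t))
          + d * (\<Sum>k\<in>UNIV. \<Sum>i\<in>UNIV. e i k t \<bullet> (\<Sum>l\<in>UNIV. B $ k $ l *\<^sub>R x i l t))"
      by (simp add: F_def inner_add_right sum.distrib sum_distrib_left)
    finally show ?thesis
      using f_part A_part B_part by (simp add: algebra_simps)
  qed
  moreover have e_le: "e i k t \<bullet> e i k t \<le> V t" for i k t
  proof -
    have "e i k t \<bullet> e i k t \<le> (\<Sum>i\<in>UNIV. e i k t \<bullet> e i k t)"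
      by (rule member_le_sum) auto
    also have "\<dots> \<le> V t"
      unfolding V_def by (rule member_le_sum) (auto intro: sum_nonneg)
    finally show ?thesis .
  qed
  moreover have "V t \<ge> 0" for t
    by (auto simp: V_def intro!: sum_nonneg)
  ultimately have "(V \<longlongrightarrow> 0) at_top"
    using neg by (intro tendsto_zero_of_derivative_le[of V V' "2 * (c * \<mu> 2 + \<alpha>)"]) auto
  then have "((\<lambda>t. 2 * sqrt (V t)) \<longlongrightarrow> 2 * sqrt 0) at_top"
    by (intro tendsto_intros)
  then have lim: "((\<lambda>t. 2 * sqrt (V t)) \<longlongrightarrow> 0) at_top"
    by simp
  \<comment> \<open>The mean cancels in the difference of two nodes of one layer, leaving two
    deviations of norm at most \<open>sqrt (V t)\<close>.\<close>
  have "norm (x i k t - x j k t) \<le> 2 * sqrt (V t)" for t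
  proof -
    have "norm (x i k t - x j k t) \<le> norm (e i k t) + norm (e j k t)"
      using norm_triangle_ineq4[of "e i k t" "e j k t"] by (simp add: e_def)
    also have "\<dots> \<le> sqrt (V t) + sqrt (V t)"
      using e_le by (intro add_mono) (simp_all add: norm_eq_sqrt_inner)
    finally show ?thesis
      by simp
  qed
  then show "((\<lambda>t. norm (x i k t - x j k t)) \<longlongrightarrow> 0) at_top"
    by (intro tendsto_sandwich[OF _ _ tendsto_const lim]) auto
qed

text \<open>The equations are unchanged when node and layer indices are transposed and the pairs
  \<open>c\<close>, \<open>A\<close> and \<open>d\<close>, \<open>B\<close> are exchanged.\<close>

lemma inter_layer_synchronizationI_swap:
  assumes "intra_layer_synchronization f d B c A"
  shows "inter_layer_synchronization f c A d B"
  unfolding inter_layer_synchronization_def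
proof (intro allI impI)
  fix x i k l
  assume "network_solution f c A d B x"
  then have "network_solution f d B c A (\<lambda>k i. x i k)"
    unfolding network_solution_def by (auto simp: add_ac)
  then show "((\<lambda>t. norm (x i k t - x i l t)) \<longlongrightarrow> 0) at_top"
    using assms unfolding intra_layer_synchronization_def by blast
qed

lemma complete_synchronizationI:
  assumes "intra_layer_synchronization f c A d B" and "inter_layer_synchronization f c A d B"
  shows "complete_synchronization f c A d B"
  unfolding complete_synchronization_def
proof (intro allI impI)
  fix x i j k l
  assume sol: "network_solution f c A d B x"
  \<comment> \<open>The path goes through \<open>x j k\<close>: first along layer \<open>k\<close>,
    then across layers at node \<open>j\<close>.\<close>
  have "((\<lambda>t. norm (x i k t - x j k t) + norm (x j k t - x j l t)) \<longlongrightarrow> 0 + 0) at_top"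
    using assms sol unfolding intra_layer_synchronization_def inter_layer_synchronization_def
    by (intro tendsto_add) blast+
  then have lim: "((\<lambda>t. norm (x i k t - x j k t) + norm (x j k t - x j l t)) \<longlongrightarrow> 0) at_top"
    by simp
  have "norm (x i k t - x j l t) \<le> norm (x i k t - x j k t) + norm (x j k t - x j l t)" for t
    using norm_triangle_ineq[of "x i k t - x j k t" "x j k t - x j l t"] by simp
  then show "((\<lambda>t. norm (x i k t - x j l t)) \<longlongrightarrow> 0) at_top"
    by (intro tendsto_sandwich[OF _ _ tendsto_const lim]) auto
qed

theorem corollary2:
  fixes f :: "real ^ 'n \<Rightarrow> real ^ 'n"
    and c d \<alpha> :: real
    and A :: "real ^ 'N ^ 'N"
    and B :: "real ^ 'K ^ 'K"
    and \<mu> \<nu> :: "nat \<Rightarrow> real"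
  assumes "CARD('N) \<ge> 2" and "CARD('K) \<ge> 2"
    and "c \<ge> 0" and "d \<ge> 0"
    and "continuous_on UNIV f"
    and "\<And>x y. (x - y) \<bullet> (f x - f y) \<le> \<alpha> * ((x - y) \<bullet> (x - y))"
    and "coupling_matrix A" and "coupling_matrix B"
    and "ordered_eigenvalues A \<mu>" and "\<mu> 1 = 0"
    and "ordered_eigenvalues B \<nu>" and "\<nu> 1 = 0"
  shows "(c * \<mu> 2 + \<alpha> < 0 \<longrightarrow> intra_layer_synchronization f c A d B) \<and>
         (d * \<nu> 2 + \<alpha> < 0 \<longrightarrow> inter_layer_synchronization f c A d B) \<and>
         (max (c * \<mu> 2) (d * \<nu> 2) + \<alpha> < 0 \<longrightarrow> complete_synchronization f c A d B)"
proof -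
  have intra: "intra_layer_synchronization f c A d B" if "c * \<mu> 2 + \<alpha> < 0"
    using assms that by (intro intra_layer_synchronizationI[of c d f \<alpha> A B \<mu>]) auto
  have inter: "inter_layer_synchronization f c A d B" if "d * \<nu> 2 + \<alpha> < 0"
    using assms that by (intro inter_layer_synchronizationI_swap intra_layer_synchronizationI[of d c f \<alpha> B A \<nu>]) auto
  show ?thesis
    using intra inter by (auto intro!: complete_synchronizationI)
qed

end
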